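(* Let $\mathcal{X}=\{\pmb{x}\in\{0,1\}^n:\pmb{A}\pmb{x}\ge\pmb{b}\}$, let $\Xi=\mathbb{R}^n_+$, let $\hat{\pmb{\xi}}_1,\dots,\hat{\pmb{\xi}}_N\in\mathbb{R}^n_+$ with $\widehat{\mathbb{P}}^N=(\hat{\pmb{\xi}}_1,\dots,\hat{\pmb{\xi}}_N)$, $\epsilon\ge0$, $\alpha\in(0,1]$, $q\in[1,\infty]$. Then the problem $\textsc{Distr}\ \mathcal{P}$, $$\min_{\pmb{x}\in\mathcal{X}}\ \max_{\mathbb{P}^N\in\mathcal{B}_\epsilon(\widehat{\mathbb{P}}^N)}{\rm CVaR}^{\alpha}_{\mathbb{P}^N}[\tilde{\pmb{\xi}}^T\pmb{x}],$$ can be expressed (same feasible set, same objective function) as $$\min_{\pmb{x}\in\mathcal{X}}\ {\rm CVaR}^{\alpha}_{\widehat{\mathbb{P}}^N}[\tilde{\pmb{\xi}}^T\pmb{x}]+\gamma\,\epsilon\,\|\pmb{x}\|_{q'},$$ where $\gamma=N$ if $\alpha<\frac1N$, $\gamma=\frac1\alpha$ if $\alpha\ge\frac1N$, and $\|\cdot\|_{q'}$ is the dual norm to $\|\cdot\|_q$, i.e. $\frac1q+\frac1{q'}=1$.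
   Context: $[N]=\{1,\dots,N\}$, $[y]_+=\max\{0,y\}$. The notation $\mathbb{P}^N=(\pmb{\xi}_1,\dots,\pmb{\xi}_N)$ denotes the discrete distribution $\frac1N\sum_{i=1}^N\delta_{\pmb{\xi}_i}$ (repetitions allowed), and $\tilde{\pmb{\xi}}$ is a random vector with the distribution indicated in the subscript. For such a distribution, ${\rm CVaR}^{\alpha}_{\mathbb{P}^N}[\tilde{\pmb{\xi}}^T\pmb{x}]=\inf_{t\in\mathbb{R}}\big(t+\frac1{\alpha N}\sum_{i=1}^N[\pmb{\xi}_i^T\pmb{x}-t]_+\big)$. The ambiguity set is $$\mathcal{B}_{\epsilon}(\widehat{\mathbb{P}}^N)=\Big\{(\pmb{\xi}_1,\dots,\pmb{\xi}_N):\ \sum_{i=1}^N\|\pmb{\xi}_i-\hat{\pmb{\xi}}_i\|_q\le N\epsilon,\ \pmb{\xi}_i\in\Xi,\ i\in[N]\Big\}.$$ $\|\cdot\|_q$ is the $q$-norm on $\mathbb{R}^n$; the dual exponent of $1$ is $\infty$ and conversely. *)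

theory Defs
  imports "HOL-Analysis.Analysis"
begin

text \<open>Meant for exponents \<open>1 \<le> q \<le> \<infinity>\<close>. On \<open>real ^ 'n\<close>, \<^const>\<open>infnorm\<close> is the largest
  absolute value of a coordinate.\<close>

definition qnorm :: "ennreal \<Rightarrow> real ^ 'n \<Rightarrow> real" where
  "qnorm q x =
     (if q = \<infinity> then infnorm x
      else (\<Sum>i\<in>UNIV. \<bar>x $ i\<bar> powr enn2real q) powr (1 / enn2real q))"

definition binary_feasible :: "real ^ 'n ^ 'm \<Rightarrow> real ^ 'm \<Rightarrow> (real ^ 'n) set" where
  "binary_feasible A b = {x. (\<forall>j. x $ j \<in> {0, 1}) \<and> A *v x \<ge> b}"

definition nonneg_orthant :: "(real ^ 'n) set" where
  "nonneg_orthant = {\<xi>. \<forall>j. \<xi> $ j \<ge> 0}"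

text \<open>The tuple \<open>(\<xi> 1, \<dots>, \<xi> N)\<close> stands for the distribution putting mass \<open>1 / N\<close> on each
  listed point, repetitions counted; \<open>cvar \<alpha> N \<xi> x\<close> is the CVaR of \<open>\<xi>\<^sup>T x\<close> under it. The infimum
  is taken over a set bounded below only for \<open>N \<ge> 1\<close> and \<open>0 < \<alpha> \<le> 1\<close>.\<close>

definition cvar :: "real \<Rightarrow> nat \<Rightarrow> (nat \<Rightarrow> real ^ 'n) \<Rightarrow> real ^ 'n \<Rightarrow> real" where
  "cvar \<alpha> N \<xi> x =
     (INF t::real. t + 1 / (\<alpha> * real N) * (\<Sum>i\<in>{1..N}. max 0 (\<xi> i \<bullet> x - t)))"

text \<open>\<open>N\<close>-tuples are extensional functions on \<open>{1..N}\<close>, so distinct elements are distinct tuples.\<close>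

definition ambiguity_set ::
  "ennreal \<Rightarrow> (real ^ 'n) set \<Rightarrow> nat \<Rightarrow> real \<Rightarrow> (nat \<Rightarrow> real ^ 'n) \<Rightarrow> (nat \<Rightarrow> real ^ 'n) set" where
  "ambiguity_set q \<Xi> N \<epsilon> \<xi>hat =
     {\<xi> \<in> {1..N} \<rightarrow>\<^sub>E \<Xi>. (\<Sum>i\<in>{1..N}. qnorm q (\<xi> i - \<xi>hat i)) \<le> real N * \<epsilon>}"

definition distr_objective ::
  "ennreal \<Rightarrow> (real ^ 'n) set \<Rightarrow> real \<Rightarrow> nat \<Rightarrow> real \<Rightarrow> (nat \<Rightarrow> real ^ 'n) \<Rightarrow> real ^ 'n \<Rightarrow> real" where
  "distr_objective q \<Xi> \<alpha> N \<epsilon> \<xi>hat x = (SUP \<xi>\<in>ambiguity_set q \<Xi> N \<epsilon> \<xi>hat. cvar \<alpha> N \<xi> x)"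

definition norm_factor :: "real \<Rightarrow> nat \<Rightarrow> real" where
  "norm_factor \<alpha> N = (if \<alpha> < 1 / real N then real N else 1 / \<alpha>)"

definition regularized_objective ::
  "ennreal \<Rightarrow> real \<Rightarrow> nat \<Rightarrow> real \<Rightarrow> (nat \<Rightarrow> real ^ 'n) \<Rightarrow> real ^ 'n \<Rightarrow> real" where
  "regularized_objective q' \<alpha> N \<epsilon> \<xi>hat x = cvar \<alpha> N \<xi>hat x + norm_factor \<alpha> N * \<epsilon> * qnorm q' x"

end

theory Submission
  imports Defs
begin

text \<open>Write \<open>D = N * \<epsilon> * \<parallel>x\<parallel>\<^bsub>q'\<^esub>\<close>. By Hoelder's inequality the losses \<open>\<xi> i \<bullet> x\<close> of an admissible tuple
  exceed the nominal ones by at most \<open>D\<close> in total. For a fixed threshold \<open>t\<close> this raises the CVaR by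
  at most \<open>D / (\<alpha> * N)\<close>; replacing \<open>t\<close> by \<open>t + D\<close> shows that it also rises by at most \<open>D\<close>. The smaller of the
  two bounds is attained by spending the whole budget on a scenario of largest nominal loss, in the
  direction \<open>x / \<parallel>x\<parallel>\<^bsub>q\<^esub>\<close>, which is aligned with \<open>x\<close> in the sense of Hoelder because \<open>x\<close> is binary,
  and nonnegative, so that the support constraint \<open>\<Xi> = \<real>\<^sup>n\<^sub>+\<close> is respected.\<close>

section \<open>Hoelder's inequality and conjugate exponents\<close>

text \<open>After scaling both families to unit norm, Young's inequality applied termwise bounds the
  sum by \<open>1 / p + 1 / q = 1\<close>. Scaling is impossible when \<open>A\<close> or
  \<open>B\<close> vanishes, but then every product is zero.\<close>

lemma Holder_inequality_sum:
  fixes a b :: "'i \<Rightarrow> real"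
  assumes pq: "p > 1" "q > 1" "1 / p + 1 / q = 1"
    and nonneg: "\<And>i. i \<in> I \<Longrightarrow> a i \<ge> 0" "\<And>i. i \<in> I \<Longrightarrow> b i \<ge> 0"
  shows "(\<Sum>i\<in>I. a i * b i) \<le> (\<Sum>i\<in>I. a i powr p) powr (1 / p) * (\<Sum>i\<in>I. b i powr q) powr (1 / q)"
proof -
  define A where "A = (\<Sum>i\<in>I. a i powr p)"
  define B where "B = (\<Sum>i\<in>I. b i powr q)"
  have "A \<ge> 0" "B \<ge> 0"
    by (auto simp: A_def B_def intro: sum_nonneg)
  consider "infinite I" | "finite I" "A = 0" | "finite I" "B = 0" | "finite I" "A > 0" "B > 0"
    using \<open>A \<ge> 0\<close> \<open>B \<ge> 0\<close> by fastforce
  then have "(\<Sum>i\<in>I. a i * b i) \<le> A powr (1 / p) * B powr (1 / q)"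
  proof cases
    case 1
    then show ?thesis by simp
  next
    case 2
    then have "a i = 0" if "i \<in> I" for i
      using that by (simp add: A_def sum_nonneg_eq_0_iff)
    then show ?thesis by simp
  next
    case 3
    then have "b i = 0" if "i \<in> I" for i
      using that by (simp add: B_def sum_nonneg_eq_0_iff)
    then show ?thesis by simp
  next
    case 4
    let ?A = "A powr (1 / p)" and ?B = "B powr (1 / q)"
    have pos: "?A > 0" "?B > 0" using 4 by auto
    have pw: "?A powr p = A" "?B powr q = B"
      using pq 4 by (simp_all add: powr_powr)
    have "(\<Sum>i\<in>I. (a i / ?A) * (b i / ?B)) \<le> (\<Sum>i\<in>I. (a i / ?A) powr p / p + (b i / ?B) powr q / q)"
      using pq nonneg by (intro sum_mono Youngs_inequality) auto
    also have "\<dots> = (\<Sum>i\<in>I. a i powr p / (A * p) + b i powr q / (B * q))"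
      using nonneg pw by (intro sum.cong) (simp_all add: powr_divide)
    also have "\<dots> = A / (A * p) + B / (B * q)"
      by (simp add: sum.distrib A_def B_def flip: sum_divide_distrib)
    also have "\<dots> = 1"
      using pq 4 by simp
    finally have "(\<Sum>i\<in>I. a i * b i) / (?A * ?B) \<le> 1"
      by (simp add: sum_divide_distrib)
    then show ?thesis
      using pos by (simp add: divide_le_eq)
  qed
  then show ?thesis by (simp add: A_def B_def)
qed

text \<open>Separates the two endpoint pairs from the exponents strictly between, which are real
  numbers above 1 as Hoelder's inequality demands.\<close>

lemma conjugate_exponents_cases:
  fixes q q' :: ennreal
  assumes "q \<ge> 1" "1 / q + 1 / q' = 1"
  obtains (one) "q = 1" "q' = \<infinity>"
  | (infinity) "q = \<infinity>" "q' = 1"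
  | (real) r s where "q = ennreal r" "q' = ennreal s" "r > 1" "s > 1" "1 / r + 1 / s = 1"
proof (cases q)
  case (real r)
  then have r: "r \<ge> 1" using assms(1) by (simp flip: ennreal_1)
  show ?thesis
  proof (cases q')
    case (real s)
    \<comment> \<open>In \<open>ennreal\<close>, \<open>1 / 0\<close> is \<infinity>, so
      \<open>q' = 0\<close> would make the left side of the conjugacy equation infinite.\<close>
    have "s \<noteq> 0"
    proof
      assume "s = 0"
      then show False using assms(2) real by (simp add: divide_ennreal_def)
    qed
    then have s: "s > 0" using real by simp
    have eq: "1 / r + 1 / s = 1"
      using assms(2) r s \<open>q = ennreal r\<close> \<open>q' = ennreal s\<close>
      by (simp add: divide_ennreal flip: ennreal_1 ennreal_plus)
    have "1 / r > 0" "1 / s > 0" using r s by auto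
    then have "1 / r < 1" "1 / s < 1" using eq by linarith+
    then have "r > 1" "s > 1" using r s by auto
    then show ?thesis using that(3) eq \<open>q = ennreal r\<close> \<open>q' = ennreal s\<close> by blast
  next
    case top
    then have "ennreal (1 / r) = ennreal 1"
      using assms(2) r \<open>q = ennreal r\<close> by (simp add: divide_ennreal flip: ennreal_1)
    then have "r = 1" using r by simp
    then show ?thesis using that(1) top \<open>q = ennreal r\<close> by simp
  qed
next
  case top
  then have "inverse q' = 1"
    using assms(2) by (simp add: divide_ennreal_def)
  then have "q' = 1"
  proof (cases q')
    case (real s)
    with \<open>inverse q' = 1\<close> have "s \<noteq> 0" by auto
    with real \<open>inverse q' = 1\<close> show ?thesis by (simp add: inverse_ennreal ennreal_eq_1)
  qed simp
  then show ?thesis using that(2) top by simp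
qed

section \<open>The q-norm, its dual, and binary vectors\<close>

lemma qnorm_nonneg: "qnorm q x \<ge> 0"
  by (simp add: qnorm_def infnorm_pos_le)

lemma qnorm_scaleR:
  assumes "q \<ge> 1"
  shows "qnorm q (c *\<^sub>R x) = \<bar>c\<bar> * qnorm q x"
proof (cases q)
  case (real r)
  then have r: "r \<ge> 1" using assms by (simp flip: ennreal_1)
  have "(\<Sum>i\<in>UNIV. \<bar>(c *\<^sub>R x) $ i\<bar> powr r) = \<bar>c\<bar> powr r * (\<Sum>i\<in>UNIV. \<bar>x $ i\<bar> powr r)"
    by (simp add: abs_mult powr_mult sum_distrib_left)
  then show ?thesis
    using real r by (simp add: qnorm_def powr_mult powr_powr sum_nonneg)
qed (simp add: qnorm_def infnorm_mul)

text \<open>Serves both endpoint pairs of exponents, with the two vectors swapped when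
  \<open>q\<close> is \<infinity>.\<close>

lemma abs_inner_le_qnorm_1_infnorm:
  fixes u x :: "real ^ 'n"
  shows "\<bar>u \<bullet> x\<bar> \<le> qnorm 1 u * infnorm x"
proof -
  have "\<bar>u \<bullet> x\<bar> \<le> (\<Sum>i\<in>UNIV. \<bar>u $ i\<bar> * \<bar>x $ i\<bar>)"
    unfolding inner_vec_def by (rule order_trans[OF sum_abs]) (simp add: abs_mult)
  also have "\<dots> \<le> (\<Sum>i\<in>UNIV. \<bar>u $ i\<bar> * infnorm x)"
    by (intro sum_mono mult_left_mono component_le_infnorm_cart) auto
  also have "\<dots> = qnorm 1 u * infnorm x"
    by (simp add: qnorm_def sum_nonneg flip: sum_distrib_right)
  finally show ?thesis .
qed

lemma abs_inner_le_qnorm: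
  fixes u x :: "real ^ 'n"
  assumes "q \<ge> 1" "1 / q + 1 / q' = 1"
  shows "\<bar>u \<bullet> x\<bar> \<le> qnorm q u * qnorm q' x"
  using assms
proof (cases rule: conjugate_exponents_cases)
  case one
  then show ?thesis using abs_inner_le_qnorm_1_infnorm[of u x] by (simp add: qnorm_def)
next
  case infinity
  then show ?thesis
    using abs_inner_le_qnorm_1_infnorm[of x u] by (simp add: qnorm_def inner_commute mult.commute)
next
  case (real r s)
  have "\<bar>u \<bullet> x\<bar> \<le> (\<Sum>i\<in>UNIV. \<bar>u $ i\<bar> * \<bar>x $ i\<bar>)"
    unfolding inner_vec_def by (rule order_trans[OF sum_abs]) (simp add: abs_mult)
  also have "\<dots> \<le> (\<Sum>i\<in>UNIV. \<bar>u $ i\<bar> powr r) powr (1 / r) * (\<Sum>i\<in>UNIV. \<bar>x $ i\<bar> powr s) powr (1 / s)"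
    using real by (intro Holder_inequality_sum) auto
  finally show ?thesis using real by (simp add: qnorm_def)
qed

text \<open>The sum of powers merely counts ones. Since
  \<open>enn2real (1 / \<infinity>) = 0\<close>, the same formula gives 1 for the maximum
  norm.\<close>

lemma qnorm_binary:
  fixes x :: "real ^ 'n"
  assumes "\<And>j. x $ j \<in> {0, 1}" "x \<noteq> 0" "q \<ge> 1"
  shows "qnorm q x = real (card {j. x $ j = 1}) powr enn2real (1 / q)"
proof (cases q)
  case (real r)
  then have r: "r \<ge> 1" using assms by (simp flip: ennreal_1)
  have "(\<Sum>i\<in>UNIV. \<bar>x $ i\<bar> powr r) = (\<Sum>i\<in>UNIV. if x $ i = 1 then 1 else 0)"
    using assms(1) by (intro sum.cong refl) fastforce
  also have "\<dots> = real (card {j. x $ j = 1})"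
    by (simp add: sum.If_cases)
  finally show ?thesis
    using real r by (simp add: qnorm_def divide_ennreal flip: ennreal_1)
next
  case top
  obtain j where "x $ j = 1"
    using assms(1,2) by (metis insertE singletonD vec_eq_iff zero_index)
  then have "card {j. x $ j = 1} \<noteq> 0" by auto
  moreover have "infnorm x = 1"
  proof (rule antisym)
    have "\<bar>x $ i\<bar> \<le> 1" for i using assms(1)[of i] by auto
    then show "infnorm x \<le> 1"
      unfolding infnorm_cart by (intro cSup_least) auto
    show "infnorm x \<ge> 1"
      using component_le_infnorm_cart[of x j] \<open>x $ j = 1\<close> by simp
  qed
  ultimately show ?thesis using top by (simp add: qnorm_def)
qed

text \<open>A binary \<open>x\<close> with \<open>k > 0\<close> ones gives equality in Hoelder when
  paired with itself: \<open>x \<bullet> x = k\<close>, which is the product of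
  \<open>k powr (1 / q)\<close> and \<open>k powr (1 / q')\<close>. Hence \<open>x\<close> divided
  by its q-norm is a witness.\<close>

lemma qnorm_dual_attained_binary:
  fixes x :: "real ^ 'n"
  assumes bin: "\<And>j. x $ j \<in> {0, 1}" and "q \<ge> 1" "1 / q + 1 / q' = 1"
  obtains v where "v \<in> nonneg_orthant" "qnorm q v \<le> 1" "v \<bullet> x = qnorm q' x"
proof (cases "x = 0")
  case True
  \<comment> \<open>Needed to apply \<open>qnorm_scaleR\<close> with scalar 0, which shows that both
    norms of the zero vector are 0.\<close>
  have "q' \<ge> 1"
    using assms(2,3) by (cases rule: conjugate_exponents_cases) auto
  then have "qnorm q (0 :: real ^ 'n) = 0" "qnorm q' (0 :: real ^ 'n) = 0"
    using qnorm_scaleR[of _ 0 "0 :: real ^ 'n"] assms(2) by auto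
  then show ?thesis
    using True that[of 0] by (simp add: nonneg_orthant_def)
next
  case False
  define k where "k = real (card {j. x $ j = 1})"
  obtain j where "x $ j = 1"
    using bin False by (metis insertE singletonD vec_eq_iff zero_index)
  then have k: "k > 0" by (auto simp: k_def card_gt_0_iff)
  have "q' \<ge> 1" and conj: "enn2real (1 / q) + enn2real (1 / q') = 1"
    using assms(2,3) by (cases rule: conjugate_exponents_cases; simp add: divide_ennreal flip: ennreal_1)+
  have norms: "qnorm q x = k powr enn2real (1 / q)" "qnorm q' x = k powr enn2real (1 / q')"
    using qnorm_binary[OF bin False] assms(2) \<open>q' \<ge> 1\<close> by (auto simp: k_def)
  have "x \<bullet> x = (\<Sum>i\<in>UNIV. if x $ i = 1 then 1 else 0)"
    unfolding inner_vec_def using bin by (intro sum.cong refl) fastforce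
  also have "\<dots> = k"
    by (simp add: sum.If_cases k_def)
  also have "\<dots> = qnorm q x * qnorm q' x"
    using k conj by (simp add: norms flip: powr_add)
  finally have inner: "x \<bullet> x = qnorm q x * qnorm q' x" .
  have pos: "qnorm q x > 0" using k by (simp add: norms)
  show ?thesis
  proof (rule that[of "(1 / qnorm q x) *\<^sub>R x"])
    have "x $ i \<ge> 0" for i using bin[of i] by auto
    then show "(1 / qnorm q x) *\<^sub>R x \<in> nonneg_orthant"
      using pos by (simp add: nonneg_orthant_def)
    show "qnorm q ((1 / qnorm q x) *\<^sub>R x) \<le> 1"
      using pos assms(2) by (simp add: qnorm_scaleR)
    show "(1 / qnorm q x) *\<^sub>R x \<bullet> x = qnorm q' x"
      using pos inner by simp
  qed
qed

section \<open>CVaR as an infimum over thresholds, and its sensitivity to the losses\<close>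

definition cvar_value :: "real \<Rightarrow> nat \<Rightarrow> (nat \<Rightarrow> real ^ 'n) \<Rightarrow> real ^ 'n \<Rightarrow> real \<Rightarrow> real" where
  "cvar_value \<alpha> N \<xi> x t = t + 1 / (\<alpha> * real N) * (\<Sum>i\<in>{1..N}. max 0 (\<xi> i \<bullet> x - t))"

lemma cvar_eq_INF_cvar_value: "cvar \<alpha> N \<xi> x = (INF t. cvar_value \<alpha> N \<xi> x t)"
  by (simp add: cvar_def cvar_value_def)

text \<open>The smallest loss \<open>m\<close> is a lower bound: replacing every loss by
  \<open>m\<close> can only decrease the value, and then \<open>1 / \<alpha> \<ge> 1\<close> makes
  the excess term at least \<open>m - t\<close>. Boundedness is what lets the real infimum be
  compared with its members.\<close>

lemma bdd_below_cvar_value: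
  assumes "N \<ge> 1" "0 < \<alpha>" "\<alpha> \<le> 1"
  shows "bdd_below (range (cvar_value \<alpha> N \<xi> x))"
proof (rule bdd_belowI2)
  fix t
  define m where "m = Min ((\<lambda>i. \<xi> i \<bullet> x) ` {1..N})"
  have m: "m \<le> \<xi> i \<bullet> x" if "i \<in> {1..N}" for i
    using that by (auto simp: m_def)
  have "m - t \<le> 1 / \<alpha> * max 0 (m - t)"
    using assms mult_right_mono[of 1 "1 / \<alpha>" "max 0 (m - t)"] by simp
  also have "\<dots> = 1 / (\<alpha> * real N) * (\<Sum>i\<in>{1..N}. max 0 (m - t))"
    using assms by simp
  also have "\<dots> \<le> 1 / (\<alpha> * real N) * (\<Sum>i\<in>{1..N}. max 0 (\<xi> i \<bullet> x - t))"
    using assms m by (intro mult_left_mono sum_mono max.mono) auto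
  finally show "m \<le> cvar_value \<alpha> N \<xi> x t"
    by (simp add: cvar_value_def)
qed

lemma cvar_le_cvar_value:
  assumes "N \<ge> 1" "0 < \<alpha>" "\<alpha> \<le> 1"
  shows "cvar \<alpha> N \<xi> x \<le> cvar_value \<alpha> N \<xi> x t"
  unfolding cvar_eq_INF_cvar_value by (rule cINF_lower[OF bdd_below_cvar_value[OF assms]]) simp

lemma cvar_greatest: "(\<And>t. m \<le> cvar_value \<alpha> N \<xi> x t) \<Longrightarrow> m \<le> cvar \<alpha> N \<xi> x"
  unfolding cvar_eq_INF_cvar_value by (rule cINF_greatest) auto

text \<open>The case distinction asks whether \<open>1 / (\<alpha> * N)\<close> exceeds 1, that is,
  which of the two bounds on the rise of the CVaR is smaller. The outer factor \<open>N\<close>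
  comes from the budget \<open>N * \<epsilon>\<close>.\<close>

lemma norm_factor_eq_min:
  assumes "N \<ge> 1" "0 < \<alpha>"
  shows "norm_factor \<alpha> N = real N * min 1 (1 / (\<alpha> * real N))"
  using assms by (auto simp: norm_factor_def min_def field_simps)

lemma cvar_le_add:
  assumes "N \<ge> 1" "0 < \<alpha>" "\<alpha> \<le> 1"
    and D: "(\<Sum>i\<in>{1..N}. \<bar>\<xi> i \<bullet> x - \<eta> i \<bullet> x\<bar>) \<le> D"
  shows "cvar \<alpha> N \<xi> x \<le> cvar \<alpha> N \<eta> x + min 1 (1 / (\<alpha> * real N)) * D"
proof -
  let ?c = "1 / (\<alpha> * real N)"
  have c: "?c > 0" using assms by simp
  have "D \<ge> 0" using D by (rule order_trans[rotated]) (simp add: sum_nonneg)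
  have "cvar \<alpha> N \<xi> x - min 1 ?c * D \<le> cvar_value \<alpha> N \<eta> x t" for t
  proof -
    \<comment> \<open>No single loss rises by more than \<open>D\<close>, so moving the threshold to
      \<open>t + D\<close> absorbs all increases at cost \<open>D\<close>.\<close>
    have "cvar \<alpha> N \<xi> x - D \<le> cvar_value \<alpha> N \<eta> x t"
    proof -
      have "\<xi> i \<bullet> x \<le> \<eta> i \<bullet> x + D" if "i \<in> {1..N}" for i
        using member_le_sum[of i "{1..N}" "\<lambda>i. \<bar>\<xi> i \<bullet> x - \<eta> i \<bullet> x\<bar>"] that D by fastforce
      then have "(\<Sum>i\<in>{1..N}. max 0 (\<xi> i \<bullet> x - (t + D))) \<le> (\<Sum>i\<in>{1..N}. max 0 (\<eta> i \<bullet> x - t))"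
        by (intro sum_mono max.mono) (auto simp: algebra_simps)
      then have "cvar_value \<alpha> N \<xi> x (t + D) \<le> cvar_value \<alpha> N \<eta> x t + D"
        unfolding cvar_value_def using c by (simp add: divide_right_mono)
      then show ?thesis
        using cvar_le_cvar_value[OF assms(1-3), of \<xi> x "t + D"] by linarith
    qed
    \<comment> \<open>Here the threshold stays at \<open>t\<close>; the positive part is
      1-Lipschitz, so the excesses grow by at most \<open>D\<close> in total.\<close>
    moreover have "cvar \<alpha> N \<xi> x - ?c * D \<le> cvar_value \<alpha> N \<eta> x t"
    proof -
      have "(\<Sum>i\<in>{1..N}. max 0 (\<xi> i \<bullet> x - t))
          \<le> (\<Sum>i\<in>{1..N}. max 0 (\<eta> i \<bullet> x - t) + \<bar>\<xi> i \<bullet> x - \<eta> i \<bullet> x\<bar>)"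
        by (intro sum_mono) linarith
      also have "\<dots> \<le> (\<Sum>i\<in>{1..N}. max 0 (\<eta> i \<bullet> x - t)) + D"
        using D by (simp add: sum.distrib)
      finally have "?c * (\<Sum>i\<in>{1..N}. max 0 (\<xi> i \<bullet> x - t))
          \<le> ?c * ((\<Sum>i\<in>{1..N}. max 0 (\<eta> i \<bullet> x - t)) + D)"
        using c by (intro mult_left_mono) auto
      then have "cvar_value \<alpha> N \<xi> x t \<le> cvar_value \<alpha> N \<eta> x t + ?c * D"
        unfolding cvar_value_def by (simp only: distrib_left)
      then show ?thesis
        using cvar_le_cvar_value[OF assms(1-3), of \<xi> x t] by linarith
    qed
    ultimately show ?thesis
      by (cases "1 \<le> ?c") (simp_all add: min_def)
  qed
  then have "cvar \<alpha> N \<xi> x - min 1 ?c * D \<le> cvar \<alpha> N \<eta> x"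
    by (rule cvar_greatest)
  then show ?thesis by linarith
qed

text \<open>A threshold below the largest loss \<open>?M\<close> counts the extra \<open>D\<close>
  in full, with weight \<open>?c\<close>. A higher threshold itself costs \<open>t - ?M\<close> more
  than \<open>?M\<close>, with weight 1, and only the rest of \<open>D\<close> has weight
  \<open>?c\<close>. Both weights are at least \<open>min 1 ?c\<close>.\<close>

lemma cvar_fun_upd_ge:
  assumes "N \<ge> 1" "0 < \<alpha>" "\<alpha> \<le> 1" "D \<ge> 0"
    and k: "k \<in> {1..N}" and largest: "\<And>i. i \<in> {1..N} \<Longrightarrow> \<eta> i \<bullet> x \<le> \<eta> k \<bullet> x"
    and \<zeta>: "\<zeta> \<bullet> x = \<eta> k \<bullet> x + D"
  shows "cvar \<alpha> N \<eta> x + min 1 (1 / (\<alpha> * real N)) * D \<le> cvar \<alpha> N (\<eta>(k := \<zeta>)) x"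
proof (rule cvar_greatest)
  fix t
  let ?c = "1 / (\<alpha> * real N)" and ?M = "\<eta> k \<bullet> x"
  define R where "R = (\<Sum>i\<in>{1..N} - {k}. max 0 (\<eta> i \<bullet> x - t))"
  have c: "?c > 0" using assms by simp
  have min_le: "min 1 ?c * D \<le> ?c * D" "min 1 ?c * D \<le> D"
    using \<open>D \<ge> 0\<close> mult_right_mono[of "min 1 ?c" ?c D] mult_right_mono[of "min 1 ?c" 1 D] by simp_all
  have "R \<ge> 0" by (simp add: R_def sum_nonneg)
  have upd: "cvar_value \<alpha> N (\<eta>(k := \<zeta>)) x t = t + ?c * (max 0 (?M + D - t) + R)"
    using k \<zeta> by (simp add: cvar_value_def R_def sum.remove[of _ k])
  have old: "cvar_value \<alpha> N \<eta> x t = t + ?c * (max 0 (?M - t) + R)"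
    using k by (simp add: cvar_value_def R_def sum.remove[of _ k])
  show "cvar \<alpha> N \<eta> x + min 1 ?c * D \<le> cvar_value \<alpha> N (\<eta>(k := \<zeta>)) x t"
  proof (cases "t \<le> ?M")
    case True
    then have "max 0 (?M + D - t) + R = (max 0 (?M - t) + R) + D"
      using \<open>D \<ge> 0\<close> by simp
    then have "cvar_value \<alpha> N (\<eta>(k := \<zeta>)) x t = cvar_value \<alpha> N \<eta> x t + ?c * D"
      unfolding upd old by (simp only: distrib_left)
    then show ?thesis
      using cvar_le_cvar_value[OF assms(1-3), of \<eta> x t] min_le by linarith
  next
    case False
    \<comment> \<open>The old CVaR is compared with its value at threshold \<open>?M\<close> instead
      of \<open>t\<close>; there no nominal loss is in excess, because \<open>k\<close> has the
      largest one.\<close>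
    have "(\<Sum>i\<in>{1..N}. max 0 (\<eta> i \<bullet> x - ?M)) = 0"
      using largest by (intro sum.neutral) auto
    then have "cvar \<alpha> N \<eta> x \<le> ?M"
      using cvar_le_cvar_value[OF assms(1-3), of \<eta> x ?M] by (simp add: cvar_value_def)
    moreover have "min 1 ?c * D \<le> (t - ?M) + ?c * max 0 (?M + D - t)"
    proof (cases "D \<le> t - ?M")
      case True
      then have "max 0 (?M + D - t) = 0" by simp
      then show ?thesis using min_le True by simp
    next
      case less: False
      \<comment> \<open>\<open>D\<close> is split at the threshold: the part up to \<open>t\<close>
        is covered by the threshold, the part above it by the excess of scenario
        \<open>k\<close>.\<close>
      have "min 1 ?c * D = min 1 ?c * (t - ?M) + min 1 ?c * (?M + D - t)"
        by (simp add: algebra_simps)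
      also have "\<dots> \<le> 1 * (t - ?M) + ?c * (?M + D - t)"
        using False less by (intro add_mono mult_right_mono) auto
      finally show ?thesis using less by (simp add: max_def)
    qed
    moreover have "?c * max 0 (?M + D - t) \<le> ?c * (max 0 (?M + D - t) + R)"
      using c \<open>R \<ge> 0\<close> by (intro mult_left_mono) auto
    ultimately show ?thesis unfolding upd by linarith
  qed
qed

section \<open>The worst case over the ambiguity set\<close>

lemma cvar_le_regularized_objective:
  assumes "N \<ge> 1" "0 < \<alpha>" "\<alpha> \<le> 1" "q \<ge> 1" "1 / q + 1 / q' = 1"
    and \<xi>: "\<xi> \<in> ambiguity_set q \<Xi> N \<epsilon> \<xi>hat"
  shows "cvar \<alpha> N \<xi> x \<le> regularized_objective q' \<alpha> N \<epsilon> \<xi>hat x"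
proof -
  \<comment> \<open>Hoelder in each scenario turns the transport budget into a bound on the total
    change of losses.\<close>
  have "(\<Sum>i\<in>{1..N}. \<bar>\<xi> i \<bullet> x - \<xi>hat i \<bullet> x\<bar>) \<le> (\<Sum>i\<in>{1..N}. qnorm q (\<xi> i - \<xi>hat i) * qnorm q' x)"
    using abs_inner_le_qnorm[OF assms(4,5)] by (intro sum_mono) (simp flip: inner_diff_left)
  also have "\<dots> \<le> real N * \<epsilon> * qnorm q' x"
    using \<xi> unfolding ambiguity_set_def
    by (simp add: qnorm_nonneg mult_right_mono flip: sum_distrib_right)
  finally have "cvar \<alpha> N \<xi> x \<le> cvar \<alpha> N \<xi>hat x + min 1 (1 / (\<alpha> * real N)) * (real N * \<epsilon> * qnorm q' x)"
    by (rule cvar_le_add[OF assms(1-3)])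
  then show ?thesis
    using assms(1,2) by (simp add: regularized_objective_def norm_factor_eq_min mult_ac)
qed

lemma regularized_objective_attained:
  fixes x :: "real ^ 'n"
  assumes "N \<ge> 1" "0 < \<alpha>" "\<alpha> \<le> 1" "q \<ge> 1" "1 / q + 1 / q' = 1" "\<epsilon> \<ge> 0"
    and \<xi>hat: "\<xi>hat \<in> {1..N} \<rightarrow>\<^sub>E nonneg_orthant"
    and bin: "\<And>j. x $ j \<in> {0, 1}"
  obtains \<xi> where "\<xi> \<in> ambiguity_set q nonneg_orthant N \<epsilon> \<xi>hat"
    "cvar \<alpha> N \<xi> x = regularized_objective q' \<alpha> N \<epsilon> \<xi>hat x"
proof -
  obtain v where v: "v \<in> nonneg_orthant" "qnorm q v \<le> 1" "v \<bullet> x = qnorm q' x"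
    using qnorm_dual_attained_binary[OF bin assms(4,5)] by blast
  obtain k where k: "k \<in> {1..N}" and largest: "\<And>i. i \<in> {1..N} \<Longrightarrow> \<xi>hat i \<bullet> x \<le> \<xi>hat k \<bullet> x"
  proof -
    have "Max ((\<lambda>i. \<xi>hat i \<bullet> x) ` {1..N}) \<in> (\<lambda>i. \<xi>hat i \<bullet> x) ` {1..N}"
      using \<open>N \<ge> 1\<close> by (intro Max_in) auto
    then obtain k where "k \<in> {1..N}" "Max ((\<lambda>i. \<xi>hat i \<bullet> x) ` {1..N}) = \<xi>hat k \<bullet> x"
      by auto
    then show ?thesis
      using that by (metis Max_ge finite_atLeastAtMost finite_imageI imageI)
  qed
  define D where "D = real N * \<epsilon> * qnorm q' x"
  \<comment> \<open>The whole budget goes to scenario \<open>k\<close>. As \<open>v\<close> has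
    q-norm at most 1 and attains the dual norm, the move costs at most \<open>N * \<epsilon>\<close>
    and raises the loss by exactly \<open>D\<close>.\<close>
  define \<zeta> where "\<zeta> = \<xi>hat k + (real N * \<epsilon>) *\<^sub>R v"
  have in_set: "\<xi>hat(k := \<zeta>) \<in> ambiguity_set q nonneg_orthant N \<epsilon> \<xi>hat"
  proof -
    have "\<xi>hat k \<in> nonneg_orthant" using \<xi>hat k by auto
    then have "\<zeta> \<in> nonneg_orthant"
      using v \<open>\<epsilon> \<ge> 0\<close> by (simp add: \<zeta>_def nonneg_orthant_def)
    then have "\<xi>hat(k := \<zeta>) \<in> {1..N} \<rightarrow>\<^sub>E nonneg_orthant"
      using \<xi>hat k by (auto simp: PiE_iff extensional_def)
    moreover have "(\<Sum>i\<in>{1..N}. qnorm q ((\<xi>hat(k := \<zeta>)) i - \<xi>hat i)) \<le> real N * \<epsilon>"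
    proof -
      have "qnorm q (0 :: real ^ 'n) = 0"
        using qnorm_scaleR[OF assms(4), of 0 "0 :: real ^ 'n"] by simp
      then have "(\<Sum>i\<in>{1..N}. qnorm q ((\<xi>hat(k := \<zeta>)) i - \<xi>hat i)) = qnorm q (\<zeta> - \<xi>hat k)"
        using k by (simp add: sum.remove[of _ k])
      also have "\<dots> = real N * \<epsilon> * qnorm q v"
        using \<open>\<epsilon> \<ge> 0\<close> by (simp add: \<zeta>_def qnorm_scaleR[OF assms(4)])
      also have "\<dots> \<le> real N * \<epsilon>"
        using v \<open>\<epsilon> \<ge> 0\<close> by (intro mult_left_le) auto
      finally show ?thesis .
    qed
    ultimately show ?thesis by (simp add: ambiguity_set_def)
  qed
  have "\<zeta> \<bullet> x = \<xi>hat k \<bullet> x + D"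
    using v by (simp add: \<zeta>_def D_def inner_add_left)
  moreover have "D \<ge> 0"
    using \<open>\<epsilon> \<ge> 0\<close> by (simp add: D_def qnorm_nonneg)
  ultimately have "cvar \<alpha> N \<xi>hat x + min 1 (1 / (\<alpha> * real N)) * D \<le> cvar \<alpha> N (\<xi>hat(k := \<zeta>)) x"
    using k largest by (intro cvar_fun_upd_ge[OF assms(1-3)])
  then have "regularized_objective q' \<alpha> N \<epsilon> \<xi>hat x \<le> cvar \<alpha> N (\<xi>hat(k := \<zeta>)) x"
    using assms(1,2) by (simp add: regularized_objective_def norm_factor_eq_min D_def mult_ac)
  then show ?thesis
    using that[OF in_set] cvar_le_regularized_objective[OF assms(1-5) in_set, of x] by simp
qed

text \<open>The first conjunct certifies that the supremum in \<open>distr_objective\<close> is a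
  maximum, as the problem requires; the others express that the two minimisation problems agree in
  objective, minimisers and optimal value.\<close>

theorem theorem3:
  fixes A :: "real ^ 'n ^ 'm" and b :: "real ^ 'm"
    and N :: nat and \<xi>hat :: "nat \<Rightarrow> real ^ 'n"
    and \<epsilon> \<alpha> :: real and q q' :: ennreal
  assumes "N \<ge> 1"
    and "\<xi>hat \<in> {1..N} \<rightarrow>\<^sub>E nonneg_orthant"
    and "\<epsilon> \<ge> 0"
    and "0 < \<alpha>" "\<alpha> \<le> 1"
    and "q \<ge> 1" "1 / q + 1 / q' = 1"
  shows "let X = binary_feasible A b;
             B = ambiguity_set q nonneg_orthant N \<epsilon> \<xi>hat;
             F = distr_objective q nonneg_orthant \<alpha> N \<epsilon> \<xi>hat;
             G = regularized_objective q' \<alpha> N \<epsilon> \<xi>hat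
         in (\<forall>x\<in>X. (\<exists>\<xi>\<in>B. cvar \<alpha> N \<xi> x = F x) \<and> (\<forall>\<xi>\<in>B. cvar \<alpha> N \<xi> x \<le> F x))
          \<and> (\<forall>x\<in>X. F x = G x)
          \<and> (\<forall>x. is_arg_min F (\<lambda>y. y \<in> X) x \<longleftrightarrow> is_arg_min G (\<lambda>y. y \<in> X) x)
          \<and> (X \<noteq> {} \<longrightarrow> Min (F ` X) = Min (G ` X))"
proof -
  define B where "B = ambiguity_set q nonneg_orthant N \<epsilon> \<xi>hat"
  define F where "F = distr_objective q nonneg_orthant \<alpha> N \<epsilon> \<xi>hat"
  define G where "G = regularized_objective q' \<alpha> N \<epsilon> \<xi>hat"
  have upper: "cvar \<alpha> N \<xi> x \<le> G x" if "\<xi> \<in> B" for \<xi> x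
    using cvar_le_regularized_objective[OF assms(1,4,5,6,7)] that by (simp add: B_def G_def)
  have attained: "\<exists>\<xi>\<in>B. cvar \<alpha> N \<xi> x = G x" if "x \<in> binary_feasible A b" for x
    using regularized_objective_attained[OF assms(1,4,5,6,7,3,2), of x] that
    unfolding B_def G_def binary_feasible_def by blast
  have FG: "F x = G x" if x: "x \<in> binary_feasible A b" for x
  proof -
    obtain \<xi> where "\<xi> \<in> B" "cvar \<alpha> N \<xi> x = G x"
      using attained[OF x] by blast
    then show ?thesis
      unfolding F_def distr_objective_def B_def[symmetric]
      \<comment> \<open>\<open>G x\<close> is both an upper bound and an attained value, so it is
        the supremum.\<close>
      using upper by (intro cSup_eq_maximum) (auto intro: rev_image_eqI)
  qed
  \<comment> \<open>Only values at feasible points enter \<open>is_arg_min\<close>, so agreement on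
    the feasible set suffices.\<close>
  have "is_arg_min F (\<lambda>y. y \<in> binary_feasible A b) x \<longleftrightarrow> is_arg_min G (\<lambda>y. y \<in> binary_feasible A b) x" for x
    using FG by (auto simp: is_arg_min_def)
  moreover have "F ` binary_feasible A b = G ` binary_feasible A b"
    using FG by (intro image_cong) auto
  ultimately show ?thesis
    unfolding Let_def B_def[symmetric] F_def[symmetric] G_def[symmetric]
    using attained upper FG by simp
qed

end
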